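(* Let $(y_n)$ be a sequence in a real Banach space $X$ and let $E \subseteq X^*$ be an isomorphically precisely norming set for $X$. If $c_0$ does not embed isomorphically in the closed linear span $[y_n]$ of $(y_n)$ and \[ \sum_n |x^*(y_n)| < \infty \quad \text{for all } x^*\in E, \] then $\sum_n y_n$ converges unconditionally in norm.
   Context: A set $E \subseteq X^*$ is called isomorphically precisely norming for a Banach space $(X,\|\cdot\|)$ if there exists $C \ge 1$ such that (a) $E \subseteq C\cdot Ba(X^* )$ (where $Ba(X^* )$ is the closed unit ball of $X^*$); (b) $\frac{1}{C}\|x\| \le \sup_{e\in E}|e(x)|$ for all $x \in X$; and (c) for every $x\in X$ there is $e_0 \in E$ with $|e_0(x)| = \sup_{e\in E}|e(x)|$. *)

theory Defs
  imports "HOL-Analysis.Analysis"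
begin

definition isomorphically_precisely_norming :: "('a::real_normed_vector \<Rightarrow>\<^sub>L real) set \<Rightarrow> bool" where
  "isomorphically_precisely_norming E \<longleftrightarrow>
     (\<exists>C::real. C \<ge> 1 \<and>
        (\<forall>e\<in>E. norm e \<le> C) \<and>
        (\<forall>x. (1 / C) * norm x \<le> (SUP e\<in>E. \<bar>blinfun_apply e x\<bar>)) \<and>
        (\<forall>x. \<exists>e0\<in>E. \<bar>blinfun_apply e0 x\<bar> = (SUP e\<in>E. \<bar>blinfun_apply e x\<bar>)))"

definition c0_seq :: "(nat \<Rightarrow> real) set" where
  "c0_seq = {s. s \<longlonglongrightarrow> 0}"

definition c0_norm :: "(nat \<Rightarrow> real) \<Rightarrow> real" where
  "c0_norm s = (SUP n. \<bar>s n\<bar>)"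

definition c0_embeds_in :: "'a::real_normed_vector set \<Rightarrow> bool" where
  "c0_embeds_in Y \<longleftrightarrow>
     (\<exists>T :: (nat \<Rightarrow> real) \<Rightarrow> 'a.
        (\<forall>s\<in>c0_seq. \<forall>t\<in>c0_seq. T (\<lambda>n. s n + t n) = T s + T t) \<and>
        (\<forall>s\<in>c0_seq. \<forall>c. T (\<lambda>n. c * s n) = c *\<^sub>R T s) \<and>
        T ` c0_seq \<subseteq> Y \<and>
        (\<exists>a b. 0 < a \<and> 0 < b \<and>
           (\<forall>s\<in>c0_seq. a * c0_norm s \<le> norm (T s) \<and> norm (T s) \<le> b * c0_norm s)))"

definition closed_span :: "'a::real_normed_vector set \<Rightarrow> 'a set" where
  "closed_span S = closure (span S)"

definition unconditionally_summable :: "(nat \<Rightarrow> 'a::real_normed_vector) \<Rightarrow> bool" where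
  "unconditionally_summable y \<longleftrightarrow> (\<forall>p. bij p \<longrightarrow> summable (\<lambda>n. y (p n)))"

end

theory Submission
  imports Defs
begin

text \<open>
  Put \<open>\<sigma> e = (\<Sum>n. \<bar>e (y n)\<bar>)\<close> for \<open>e \<in> E\<close>. If \<open>\<sigma>\<close> is bounded on \<open>E\<close>, the argument of Bessaga and
  Pelczynski applies, with \<open>E\<close> supplying the norming functionals: a series whose signed tails are not
  small has blocks equivalent to the unit vectors of \<open>c\<^sub>0\<close>.

  If \<open>\<sigma>\<close> is unbounded, normalised signed sums of the \<open>y n\<close> are unit vectors that are uniformly
  small on \<open>{e \<in> E. \<sigma> e \<le> M}\<close> for any prescribed \<open>M\<close>. Under the equivalent norm
  \<open>p x = (SUP e\<in>E. (1 + 1 / (1 + \<sigma> e)) * \<bar>e x\<bar>)\<close> the supremum is, near each nonzero point, determined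
  by such a set, because suprema over \<open>E\<close> are attained and the weight decreases to \<open>1\<close>. So one can
  keep adding and subtracting vectors \<open>u k\<close>, chosen about as long as possible, with all signed sums
  bounded. If \<open>c\<^sub>0\<close> does not embed, then by the first case the signed sums form a relatively compact
  set avoiding \<open>0\<close>; a fixed positive step length is then always possible, although \<open>u k\<close> tends
  to \<open>0\<close>.
\<close>

section \<open>Disjointification of matrices with bounded row sums\<close>

text \<open>Induction on \<open>n\<close>. Pairing splits the indices into infinitely many infinite
  columns. If no column works, each column \<open>p\<close> has a row \<open>j p\<close> with mass
  more than \<open>\<delta>\<close> on a finite set \<open>F p\<close> of that column. Keeping only
  the one index \<open>(p, j p)\<close> of each column discards that mass, so the bound drops to
  \<open>n * \<delta>\<close>.\<close>

lemma rosenthal_disjointification: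
  fixes \<mu> :: "nat \<Rightarrow> nat \<Rightarrow> real"
  assumes "\<And>j i. 0 \<le> \<mu> j i"
    and "\<And>j F. finite F \<Longrightarrow> (\<Sum>i\<in>F. \<mu> j i) \<le> real n * \<delta>"
    and "0 < \<delta>"
  shows "\<exists>r :: nat \<Rightarrow> nat. inj r \<and> (\<forall>j F. finite F \<longrightarrow> j \<notin> F \<longrightarrow> (\<Sum>i\<in>F. \<mu> (r j) (r i)) \<le> \<delta>)"
  using assms
proof (induction n arbitrary: \<mu>)
  case 0
  have "(\<Sum>i\<in>F. \<mu> (id j) (id i)) \<le> \<delta>" if "finite F" for j F
    using "0.prems"(2)[OF that, of j] "0.prems"(3) by simp
  then show ?case by (intro exI[of _ id] conjI allI impI) auto
next
  case (Suc n)
  let ?c = "\<lambda>p q. prod_encode (p, q)"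
  show ?case
  proof (cases "\<exists>p. \<forall>j F. finite F \<longrightarrow> j \<notin> F \<longrightarrow> (\<Sum>i\<in>F. \<mu> (?c p j) (?c p i)) \<le> \<delta>")
    case True
    then obtain p where "\<forall>j F. finite F \<longrightarrow> j \<notin> F \<longrightarrow> (\<Sum>i\<in>F. \<mu> (?c p j) (?c p i)) \<le> \<delta>"
      by blast
    moreover have "inj (?c p)" by (auto simp: inj_def prod_encode_eq)
    ultimately show ?thesis by blast
  next
    case False
    then have "\<forall>p. \<exists>j F. finite F \<and> j \<notin> F \<and> \<delta> < (\<Sum>i\<in>F. \<mu> (?c p j) (?c p i))"
      by (simp add: not_le)
    then obtain j F where jF: "\<And>p. finite (F p)" "\<And>p. j p \<notin> F p"
      "\<And>p. \<delta> < (\<Sum>i\<in>F p. \<mu> (?c p (j p)) (?c p i))"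
      by metis
    define r where "r p = ?c p (j p)" for p
    have inj: "inj r" by (auto simp: inj_def r_def prod_encode_eq)
    have "(\<Sum>i\<in>G. \<mu> (r p) (r i)) \<le> real n * \<delta>" if G: "finite G" for p G
    proof -
      have i2: "inj_on (?c p) (F p)" by (auto simp: inj_on_def prod_encode_eq)
      \<comment> \<open>A common index would lie in column \<open>p\<close>, hence equal
        \<open>r p\<close>, and would put \<open>j p\<close> into \<open>F p\<close>.\<close>
      have dis: "r ` G \<inter> ?c p ` F p = {}"
        using jF(2) by (auto simp: r_def prod_encode_eq)
      have "(\<Sum>i\<in>G. \<mu> (r p) (r i)) + \<delta> \<le> (\<Sum>i\<in>r`G. \<mu> (r p) i) + (\<Sum>i\<in>?c p ` F p. \<mu> (r p) i)"
        using jF(3)[of p] sum.reindex[OF inj_on_subset[OF inj, of G], of "\<mu> (r p)"]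
          sum.reindex[OF i2, of "\<mu> (r p)"]
        by (simp add: r_def[of p])
      also have "\<dots> = (\<Sum>i\<in>r`G \<union> ?c p ` F p. \<mu> (r p) i)"
        using G jF(1) dis by (intro sum.union_disjoint[symmetric]) auto
      also have "\<dots> \<le> real (Suc n) * \<delta>"
        using G jF(1) by (intro Suc.prems(2)) auto
      finally show ?thesis by (simp add: algebra_simps)
    qed
    then obtain r' :: "nat \<Rightarrow> nat" where r': "inj r'"
      "\<forall>j F. finite F \<longrightarrow> j \<notin> F \<longrightarrow> (\<Sum>i\<in>F. \<mu> (r (r' j)) (r (r' i))) \<le> \<delta>"
      using Suc.IH[of "\<lambda>a b. \<mu> (r a) (r b)"] Suc.prems(1,3) by blast
    then show ?thesis
      using inj_compose[OF inj r'(1)] by (intro exI[of _ "r \<circ> r'"]) (simp add: comp_def)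
  qed
qed

section \<open>Copies of \<open>c0\<close> from blocks, and small tails in their absence\<close>

lemma c0_norm_upper: "s \<in> c0_seq \<Longrightarrow> \<bar>s i\<bar> \<le> c0_norm s"
proof -
  assume "s \<in> c0_seq"
  then have "Bseq s" by (auto simp: c0_seq_def intro!: convergent_imp_Bseq convergentI)
  then have "bdd_above (range (\<lambda>n. \<bar>s n\<bar>))"
    by (auto simp: Bseq_def bdd_above_def)
  then show ?thesis unfolding c0_norm_def by (rule cSUP_upper2) auto
qed

lemma blinfun_abs_le: "\<bar>blinfun_apply (e :: 'a::real_normed_vector \<Rightarrow>\<^sub>L real) x\<bar> \<le> norm e * norm x"
  using norm_blinfun[of e x] by simp

text \<open>The embedding sends \<open>s\<close> to the sum of \<open>s i *\<^sub>R b i\<close>. The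
  bound \<open>B\<close>, read through a norming functional, gives convergence and the upper
  estimate. For the lower one, \<open>f j\<close> sees at least
  \<open>2 * \<delta> * \<bar>s j\<bar>\<close> on the diagonal and at most \<open>\<delta>\<close>
  times the norm of \<open>s\<close> off it.\<close>

lemma c0_embeds_in_of_blocks:
  fixes b :: "nat \<Rightarrow> 'a::banach" and E :: "('a \<Rightarrow>\<^sub>L real) set"
  assumes Y: "subspace Y" "closed Y" "\<And>i. b i \<in> Y"
    and C: "0 < C" "\<And>e. e \<in> E \<Longrightarrow> norm e \<le> C" "\<And>x. \<exists>e\<in>E. norm x \<le> C * \<bar>e x\<bar>"
    and B: "\<And>e F. e \<in> E \<Longrightarrow> finite F \<Longrightarrow> (\<Sum>i\<in>F. \<bar>e (b i)\<bar>) \<le> B"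
    and f: "\<And>i. f i \<in> E" "\<And>i. 2 * \<delta> \<le> \<bar>f i (b i)\<bar>" "0 < \<delta>"
      "\<And>j F. finite F \<Longrightarrow> j \<notin> F \<Longrightarrow> (\<Sum>i\<in>F. \<bar>f j (b i)\<bar>) \<le> \<delta>"
  shows "c0_embeds_in Y"
proof -
  have B0: "0 \<le> B" using B[of "f 0" "{}"] f(1) by simp
  have ub: "norm (\<Sum>i\<in>F. s i *\<^sub>R b i) \<le> C * B * m"
    if F: "finite F" and s: "\<And>i. i \<in> F \<Longrightarrow> \<bar>s i\<bar> \<le> m" and m: "0 \<le> m" for F s m
  proof -
    obtain e where e: "e \<in> E" "norm (\<Sum>i\<in>F. s i *\<^sub>R b i) \<le> C * \<bar>e (\<Sum>i\<in>F. s i *\<^sub>R b i)\<bar>"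
      using C(3) by blast
    have "\<bar>e (\<Sum>i\<in>F. s i *\<^sub>R b i)\<bar> \<le> (\<Sum>i\<in>F. \<bar>s i\<bar> * \<bar>e (b i)\<bar>)"
      by (simp add: blinfun.sum_right blinfun.scaleR_right flip: abs_mult)
    also have "\<dots> \<le> (\<Sum>i\<in>F. m * \<bar>e (b i)\<bar>)"
      by (intro sum_mono mult_right_mono s) auto
    also have "\<dots> \<le> m * B"
      unfolding sum_distrib_left[symmetric] by (intro mult_left_mono B e F m)
    finally show ?thesis
      using e(2) C(1) by (smt (verit) mult.assoc mult.commute mult_left_mono)
  qed
  define T where "T s = (\<Sum>i. s i *\<^sub>R b i)" for s :: "nat \<Rightarrow> real"
  have sm: "summable (\<lambda>i. s i *\<^sub>R b i)" if s: "s \<in> c0_seq" for s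
    unfolding summable_Cauchy
  proof (intro allI impI)
    fix \<epsilon> :: real assume \<epsilon>: "0 < \<epsilon>"
    \<comment> \<open>The added \<open>1\<close> keeps the denominator positive when
      \<open>B = 0\<close> and makes the resulting estimate strict.\<close>
    define m where "m = \<epsilon> / (C * B + 1)"
    have CB: "0 \<le> C * B" using C(1) B0 by simp
    have m: "0 < m" using \<epsilon> CB by (simp add: m_def)
    have "C * B * m < (C * B + 1) * m" using m by (simp add: algebra_simps)
    also have "\<dots> = \<epsilon>" using CB by (simp add: m_def)
    finally have lt: "C * B * m < \<epsilon>" .
    obtain N where N: "\<And>n. n \<ge> N \<Longrightarrow> \<bar>s n\<bar> < m"
      using s m LIMSEQ_D[of s 0 m] by (auto simp: c0_seq_def)
    have "norm (\<Sum>i\<in>{k..<n}. s i *\<^sub>R b i) < \<epsilon>" if "k \<ge> N" for k n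
      using ub[of "{k..<n}" s m] N m lt that
      by (smt (verit) atLeastLessThan_iff finite_atLeastLessThan le_trans)
    then show "\<exists>N. \<forall>k\<ge>N. \<forall>n. norm (\<Sum>i\<in>{k..<n}. s i *\<^sub>R b i) < \<epsilon>" by blast
  qed
  have lim: "(\<lambda>n. \<Sum>i<n. s i *\<^sub>R b i) \<longlonglongrightarrow> T s" if s: "s \<in> c0_seq" for s
    unfolding T_def using sm[OF s] by (rule summable_LIMSEQ)
  have up: "norm (T s) \<le> (C * B + 1) * c0_norm s" if s: "s \<in> c0_seq" for s
  proof -
    have c: "0 \<le> c0_norm s" using c0_norm_upper[OF s, of 0] by linarith
    have "norm (T s) \<le> C * B * c0_norm s"
      by (rule LIMSEQ_le_const2[OF tendsto_norm[OF lim[OF s]]])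
        (use ub c c0_norm_upper[OF s] in auto)
    then show ?thesis using c by (simp add: algebra_simps)
  qed
  have lo: "\<delta> / C * c0_norm s \<le> norm (T s)" if s: "s \<in> c0_seq" for s
  proof -
    let ?c = "c0_norm s"
    have c: "0 \<le> c0_norm s" using c0_norm_upper[OF s, of 0] by linarith
    \<comment> \<open>Proved for partial sums that contain the index \<open>j\<close>, then passed
      to the limit. Taking the supremum over \<open>j\<close> afterwards leaves
      \<open>\<delta> * ?c\<close> on the left.\<close>
    have "(2 * \<delta> * \<bar>s j\<bar> - \<delta> * ?c) \<le> C * norm (T s)" for j
    proof (rule LIMSEQ_le_const[OF tendsto_mult_left[OF tendsto_norm[OF lim[OF s]]]],
        intro exI allI impI)
      fix n assume n: "Suc j \<le> n"
      let ?F = "{..<n} - {j}"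
      let ?v = "\<Sum>i<n. s i *\<^sub>R b i"
      have "?v = s j *\<^sub>R b j + (\<Sum>i\<in>?F. s i *\<^sub>R b i)"
        using n by (intro sum.remove) auto
      then have v: "f j ?v = s j * f j (b j) + (\<Sum>i\<in>?F. s i * f j (b i))"
        by (simp add: blinfun.add_right blinfun.sum_right blinfun.scaleR_right)
      have "\<bar>\<Sum>i\<in>?F. s i * f j (b i)\<bar> \<le> (\<Sum>i\<in>?F. \<bar>s i\<bar> * \<bar>f j (b i)\<bar>)"
        by (simp flip: abs_mult)
      also have "\<dots> \<le> (\<Sum>i\<in>?F. ?c * \<bar>f j (b i)\<bar>)"
        by (intro sum_mono mult_right_mono c0_norm_upper s) auto
      also have "\<dots> \<le> ?c * \<delta>"
        unfolding sum_distrib_left[symmetric] by (intro mult_left_mono f(4) c) auto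
      finally have 1: "\<bar>\<Sum>i\<in>?F. s i * f j (b i)\<bar> \<le> ?c * \<delta>" .
      have "2 * \<delta> * \<bar>s j\<bar> \<le> \<bar>s j * f j (b j)\<bar>"
        using mult_right_mono[OF f(2)[of j], of "\<bar>s j\<bar>"] by (simp add: abs_mult mult.commute)
      moreover have "x - z \<le> \<bar>p + q\<bar>" if "x \<le> \<bar>p\<bar>" "\<bar>q\<bar> \<le> z" for x z p q :: real
        using that by linarith
      ultimately have "2 * \<delta> * \<bar>s j\<bar> - \<delta> * ?c \<le> \<bar>f j ?v\<bar>"
        unfolding v using 1 by (simp add: mult.commute)
      also have "\<dots> \<le> C * norm ?v"
        using blinfun_abs_le[of "f j" ?v] C(2)[OF f(1)[of j]]
        by (meson mult_right_mono norm_ge_zero order_trans)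
      finally show "2 * \<delta> * \<bar>s j\<bar> - \<delta> * ?c \<le> C * norm ?v" .
    qed
    then have "\<bar>s j\<bar> \<le> (C * norm (T s) + \<delta> * ?c) / (2 * \<delta>)" for j
      using f(3) by (simp add: pos_le_divide_eq algebra_simps)
    then have "?c \<le> (C * norm (T s) + \<delta> * ?c) / (2 * \<delta>)"
      unfolding c0_norm_def[of s] by (intro cSUP_least) (auto simp: c0_norm_def)
    then have "\<delta> * ?c \<le> C * norm (T s)"
      using f(3) by (simp add: pos_le_divide_eq algebra_simps)
    then show ?thesis using C(1) by (simp add: field_simps)
  qed
  have add: "T (\<lambda>n. s n + t n) = T s + T t" if "s \<in> c0_seq" "t \<in> c0_seq" for s t
    unfolding T_def using suminf_add[OF sm[OF that(1)] sm[OF that(2)]]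
    by (simp add: scaleR_add_left)
  have scale: "T (\<lambda>n. c * s n) = c *\<^sub>R T s" if "s \<in> c0_seq" for s c
    unfolding T_def using suminf_scaleR_right[OF sm[OF that], of c] by simp
  have mem: "T s \<in> Y" if "s \<in> c0_seq" for s
    by (rule closed_sequentially[OF Y(2) _ lim[OF that]])
      (auto intro!: subspace_sum subspace_scale Y)
  have pos: "0 < \<delta> / C" "0 < C * B + 1" using C(1) B0 f(3) by (auto simp: add_nonneg_pos)
  show ?thesis
    unfolding c0_embeds_in_def
    by (intro exI[of _ T] exI[of _ "\<delta> / C"] exI[of _ "C * B + 1"] conjI ballI allI image_subsetI
        add scale mem pos up lo)
qed

text \<open>The argument of Bessaga and Pelczynski: if the tails are not small, there are disjoint
  blocks of norm at least \<open>\<epsilon>\<close>, which inherit the bound \<open>B\<close>.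
  Disjointification of the matrix \<open>\<bar>f j (b i)\<bar>\<close>, with \<open>f j\<close>
  norming \<open>b j\<close>, yields a subsequence equivalent to the unit vectors of
  \<open>c0\<close>.\<close>

lemma signed_tails_small:
  fixes u :: "nat \<Rightarrow> 'a::banach" and E :: "('a \<Rightarrow>\<^sub>L real) set"
  assumes Y: "subspace Y" "closed Y" "\<And>i. u i \<in> Y" "\<not> c0_embeds_in Y"
    and C: "0 < C" "\<And>e. e \<in> E \<Longrightarrow> norm e \<le> C" "\<And>x. \<exists>e\<in>E. norm x \<le> C * \<bar>e x\<bar>"
    and B: "\<And>e F. e \<in> E \<Longrightarrow> finite F \<Longrightarrow> (\<Sum>i\<in>F. \<bar>e (u i)\<bar>) \<le> B"
    and "0 < \<epsilon>"
  shows "\<exists>N. \<forall>F a. finite F \<longrightarrow> F \<subseteq> {N..} \<longrightarrow> (\<forall>i\<in>F. \<bar>a i\<bar> \<le> 1) \<longrightarrow> norm (\<Sum>i\<in>F. a i *\<^sub>R u i) < \<epsilon>"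
proof (rule ccontr)
  assume "\<not> ?thesis"
  then have "\<forall>N. \<exists>F a. finite F \<and> F \<subseteq> {N..} \<and> (\<forall>i\<in>F. \<bar>a i\<bar> \<le> (1::real)) \<and> \<epsilon> \<le> norm (\<Sum>i\<in>F. a i *\<^sub>R u i)"
    by (simp add: not_less)
  then obtain F a where Fa: "\<And>N. finite (F N)" "\<And>N. F N \<subseteq> {N..}" "\<And>N i. i \<in> F N \<Longrightarrow> \<bar>a N i\<bar> \<le> (1::real)"
    "\<And>N. \<epsilon> \<le> norm (\<Sum>i\<in>F N. a N i *\<^sub>R u i)"
    by metis
  \<comment> \<open>Each block starts strictly after the preceding one. Inserting \<open>m\<close>
    makes \<open>N\<close> increase and keeps \<open>Max\<close> defined without a nonemptiness
    argument.\<close>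
  define N where "N = rec_nat 0 (\<lambda>_ m. Suc (Max (insert m (F m))))"
  define G where "G k = F (N k)" for k
  have N_Suc: "N (Suc k) = Suc (Max (insert (N k) (G k)))" for k by (simp add: N_def G_def)
  have G: "finite (G k)" "G k \<subseteq> {N k..<N (Suc k)}" for k
    using Fa(1,2)[of "N k"] by (auto simp: G_def N_Suc less_Suc_eq_le)
  have "mono N" by (rule incseq_SucI) (simp add: N_Suc less_Suc_eq_le le_SucI Fa G)
  have disj: "G k \<inter> G l = {}" if "k \<noteq> l" for k l
  proof -
    have "G k \<inter> G l = {}" if "k < l" for k l
      using monoD[OF \<open>mono N\<close>, of "Suc k" l] that G(2)[of k] G(2)[of l] by fastforce
    then show ?thesis using that by (metis Int_commute linorder_neqE_nat)
  qed
  define b where "b k = (\<Sum>i\<in>G k. a (N k) i *\<^sub>R u i)" for k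
  have b_norm: "\<epsilon> \<le> norm (b k)" for k unfolding b_def G_def by (rule Fa)
  have bB: "(\<Sum>k\<in>K. \<bar>e (b k)\<bar>) \<le> B" if e: "e \<in> E" and K: "finite K" for e K
  proof -
    have "\<bar>e (b k)\<bar> \<le> (\<Sum>i\<in>G k. \<bar>e (u i)\<bar>)" for k
    proof -
      have "\<bar>e (b k)\<bar> \<le> (\<Sum>i\<in>G k. \<bar>a (N k) i\<bar> * \<bar>e (u i)\<bar>)"
        by (simp add: b_def blinfun.sum_right blinfun.scaleR_right flip: abs_mult)
      also have "\<dots> \<le> (\<Sum>i\<in>G k. \<bar>e (u i)\<bar>)"
        using Fa(3) by (intro sum_mono mult_left_le_one_le) (auto simp: G_def)
      finally show ?thesis .
    qed
    then have "(\<Sum>k\<in>K. \<bar>e (b k)\<bar>) \<le> (\<Sum>k\<in>K. \<Sum>i\<in>G k. \<bar>e (u i)\<bar>)" by (intro sum_mono)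
    also have "\<dots> = (\<Sum>i\<in>(\<Union>k\<in>K. G k). \<bar>e (u i)\<bar>)"
      using K G disj by (intro sum.UNION_disjoint[symmetric]) auto
    also have "\<dots> \<le> B" using e K G by (intro B) auto
    finally show ?thesis .
  qed
  have "\<forall>k. \<exists>e\<in>E. norm (b k) \<le> C * \<bar>e (b k)\<bar>" using C(3) by blast
  then obtain f where f: "\<And>k. f k \<in> E" "\<And>k. norm (b k) \<le> C * \<bar>f k (b k)\<bar>" by metis
  \<comment> \<open>From \<open>\<epsilon> \<le> norm (b k)\<close> and
    \<open>norm (b k) \<le> C * \<bar>f k (b k)\<bar>\<close> the diagonal is at least
    \<open>\<epsilon> / C\<close>, which is \<open>2 * \<delta>\<close>.\<close>
  define \<delta> where "\<delta> = \<epsilon> / (2 * C)"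
  have \<delta>: "0 < \<delta>" using \<open>0 < \<epsilon>\<close> C(1) by (simp add: \<delta>_def)
  have f2: "2 * \<delta> \<le> \<bar>f k (b k)\<bar>" for k
    using order_trans[OF b_norm f(2), of k] C(1) by (simp add: \<delta>_def field_simps)
  obtain n where "B / \<delta> \<le> real n" using real_arch_simple by blast
  then have n: "B \<le> real n * \<delta>" using \<delta> by (simp add: pos_divide_le_eq)
  have "\<exists>r :: nat \<Rightarrow> nat. inj r \<and> (\<forall>j F. finite F \<longrightarrow> j \<notin> F \<longrightarrow> (\<Sum>i\<in>F. \<bar>f (r j) (b (r i))\<bar>) \<le> \<delta>)"
    by (rule rosenthal_disjointification[of "\<lambda>j i. \<bar>f j (b i)\<bar>" n])
      (use order_trans[OF bB n] f(1) \<delta> in auto)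
  then obtain r :: "nat \<Rightarrow> nat" where r: "inj r" "\<And>j F. finite F \<Longrightarrow> j \<notin> F \<Longrightarrow> (\<Sum>i\<in>F. \<bar>f (r j) (b (r i))\<bar>) \<le> \<delta>"
    by blast
  have bY: "b k \<in> Y" for k unfolding b_def by (intro subspace_sum subspace_scale Y)
  have "(\<Sum>i\<in>K. \<bar>e (b (r i))\<bar>) \<le> B" if "e \<in> E" "finite K" for e K
    using bB[OF that(1), of "r ` K"] that(2) inj_on_subset[OF r(1), of K]
    by (simp add: sum.reindex)
  then have "c0_embeds_in Y"
    by (intro c0_embeds_in_of_blocks[of Y "\<lambda>i. b (r i)" C E B "\<lambda>i. f (r i)" \<delta>])
      (use Y C f f2 \<delta> r bY in auto)
  then show False using Y(4) by blast
qed

text \<open>A bijection takes only finitely many indices to values below \<open>N\<close>, so late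
  segments of the rearranged series are sums over finite sets beyond \<open>N\<close>.\<close>

lemma unconditionally_summable_if_tails_small:
  fixes y :: "nat \<Rightarrow> 'a::banach"
  assumes "\<And>\<epsilon>. 0 < \<epsilon> \<Longrightarrow> \<exists>N. \<forall>F. finite F \<longrightarrow> F \<subseteq> {N..} \<longrightarrow> norm (\<Sum>i\<in>F. y i) < \<epsilon>"
  shows "unconditionally_summable y"
  unfolding unconditionally_summable_def summable_Cauchy
proof (intro allI impI)
  fix p :: "nat \<Rightarrow> nat" and \<epsilon> :: real assume p: "bij p" and "0 < \<epsilon>"
  obtain N where N: "\<And>F. finite F \<Longrightarrow> F \<subseteq> {N..} \<Longrightarrow> norm (\<Sum>i\<in>F. y i) < \<epsilon>"
    using assms[OF \<open>0 < \<epsilon>\<close>] by blast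
  have inj: "inj p" using p by (rule bij_is_inj)
  have "finite (p -` {..<N})" using inj by (intro finite_vimageI) auto
  then obtain M where M: "p -` {..<N} \<subseteq> {..<M}" using finite_nat_iff_bounded by blast
  have "norm (\<Sum>i\<in>{m..<n}. y (p i)) < \<epsilon>" if "m \<ge> M" for m n
  proof -
    have "p ` {m..<n} \<subseteq> {N..}"
    proof clarsimp
      fix i assume "m \<le> i"
      then have "i \<notin> p -` {..<N}" using M that by auto
      then show "N \<le> p i" by auto
    qed
    then have "norm (\<Sum>i\<in>p ` {m..<n}. y i) < \<epsilon>" by (intro N) auto
    then show ?thesis using inj_on_subset[OF inj, of "{m..<n}"] by (simp add: sum.reindex)
  qed
  then show "\<exists>M. \<forall>m\<ge>M. \<forall>n. norm (\<Sum>i\<in>{m..<n}. y (p i)) < \<epsilon>" by blast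
qed

lemma subspace_closure_normed:
  fixes S :: "'a::real_normed_vector set"
  assumes S: "subspace S"
  shows "subspace (closure S)"
proof (rule subspaceI)
  show "0 \<in> closure S" using subspace_0[OF S] closure_subset by blast
next
  fix x x' assume "x \<in> closure S" "x' \<in> closure S"
  then obtain f g where "\<forall>n. f n \<in> S" "f \<longlonglongrightarrow> x" "\<forall>n. g n \<in> S" "g \<longlonglongrightarrow> x'"
    by (auto simp: closure_sequential)
  then show "x + x' \<in> closure S"
    unfolding closure_sequential
    by (intro exI[of _ "\<lambda>n. f n + g n"]) (auto intro: tendsto_add subspace_add[OF S])
next
  fix c x assume "x \<in> closure S"
  then obtain f where "\<forall>n. f n \<in> S" "f \<longlonglongrightarrow> x" by (auto simp: closure_sequential)
  then show "c *\<^sub>R x \<in> closure S"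
    unfolding closure_sequential
    by (intro exI[of _ "\<lambda>n. c *\<^sub>R f n"]) (auto intro: tendsto_scaleR subspace_scale[OF S])
qed

section \<open>The weighted norm and its local dependence on few functionals\<close>

text \<open>The norming inequality and the attainment of the supremum are merged in
  \<open>attained\<close>: one functional is both norming for \<open>x\<close> and maximal at
  \<open>x\<close>.\<close>

locale attaining_boundary =
  fixes y :: "nat \<Rightarrow> 'a::banach" and E :: "('a \<Rightarrow>\<^sub>L real) set" and C :: real
  assumes C_pos: "0 < C"
    and norm_le: "e \<in> E \<Longrightarrow> norm e \<le> C"
    and attained: "\<exists>e\<^sub>0\<in>E. norm x \<le> C * \<bar>e\<^sub>0 x\<bar> \<and> (\<forall>e\<in>E. \<bar>e x\<bar> \<le> \<bar>e\<^sub>0 x\<bar>)"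
    and summable_y: "e \<in> E \<Longrightarrow> summable (\<lambda>n. \<bar>e (y n)\<bar>)"
begin

definition \<sigma> :: "('a \<Rightarrow>\<^sub>L real) \<Rightarrow> real" where
  "\<sigma> e = (\<Sum>n. \<bar>e (y n)\<bar>)"

definition \<phi> :: "('a \<Rightarrow>\<^sub>L real) \<Rightarrow> real" where
  "\<phi> e = 1 + 1 / (1 + \<sigma> e)"

definition p :: "'a \<Rightarrow> real" where
  "p x = (SUP e\<in>E. \<phi> e * \<bar>e x\<bar>)"

lemma norming: "\<exists>e\<in>E. norm x \<le> C * \<bar>e x\<bar>"
  using attained by blast

lemma abs_le: "e \<in> E \<Longrightarrow> \<bar>e x\<bar> \<le> C * norm x"
  using blinfun_abs_le[of e x] norm_le[of e] by (meson mult_right_mono norm_ge_zero order_trans)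

lemma \<sigma>_nonneg: "e \<in> E \<Longrightarrow> 0 \<le> \<sigma> e"
  unfolding \<sigma>_def by (intro suminf_nonneg summable_y) auto

lemma sum_le_\<sigma>: "e \<in> E \<Longrightarrow> finite F \<Longrightarrow> (\<Sum>i\<in>F. \<bar>e (y i)\<bar>) \<le> \<sigma> e"
  unfolding \<sigma>_def by (intro sum_le_suminf summable_y) auto

lemma \<phi>_bounds: "e \<in> E \<Longrightarrow> 1 \<le> \<phi> e \<and> \<phi> e \<le> 2"
  using \<sigma>_nonneg[of e] by (simp add: \<phi>_def)

lemma p_upper: "e \<in> E \<Longrightarrow> \<phi> e * \<bar>e x\<bar> \<le> p x"
proof -
  have "bdd_above ((\<lambda>e. \<phi> e * \<bar>e x\<bar>) ` E)"
    by (rule bdd_aboveI2[where M = "2 * (C * norm x)"])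
      (use abs_le \<phi>_bounds C_pos in \<open>auto intro!: mult_mono\<close>)
  then show "e \<in> E \<Longrightarrow> ?thesis" unfolding p_def by (intro cSUP_upper)
qed

lemma p_least: "(\<And>e. e \<in> E \<Longrightarrow> \<phi> e * \<bar>e x\<bar> \<le> c) \<Longrightarrow> p x \<le> c"
  unfolding p_def using norming by (intro cSUP_least) auto

lemma abs_le_p: "e \<in> E \<Longrightarrow> \<bar>e x\<bar> \<le> p x"
  using p_upper[of e x] \<phi>_bounds[of e] mult_right_mono[of 1 "\<phi> e" "\<bar>e x\<bar>"] by auto

text \<open>Let \<open>e0\<close> attain the maximum \<open>Q\<close> at \<open>x\<close>. A
  functional with \<open>\<sigma> e > M\<close> has so much less weight than \<open>e0\<close> that
  its weighted value stays below that of \<open>e0\<close> throughout a neighbourhood of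
  \<open>x\<close>. Only functionals with \<open>\<sigma> e \<le> M\<close> can raise
  \<open>p\<close>, and on these \<open>h\<close> contributes at most \<open>\<eta>\<close> times a
  weight of at most \<open>2\<close>.\<close>

lemma p_locally_determined:
  assumes "x \<noteq> 0"
  shows "\<exists>\<delta>>0. \<exists>M. \<forall>z h \<eta>. norm (z - x) < \<delta> \<longrightarrow> norm h < \<delta> \<longrightarrow> 0 \<le> \<eta> \<longrightarrow>
    (\<forall>e\<in>E. \<sigma> e \<le> M \<longrightarrow> \<bar>e h\<bar> \<le> \<eta>) \<longrightarrow> p (z + h) \<le> p z + 2 * \<eta>"
proof -
  obtain e0 where e0: "e0 \<in> E" "norm x \<le> C * \<bar>e0 x\<bar>" "\<And>e. e \<in> E \<Longrightarrow> \<bar>e x\<bar> \<le> \<bar>e0 x\<bar>"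
    using attained[of x] by blast
  define Q where "Q = \<bar>e0 x\<bar>"
  define a where "a = 1 / (1 + \<sigma> e0)"
  \<comment> \<open>Beyond this level \<open>1 + \<sigma> e\<close> exceeds
    \<open>2 * (1 + \<sigma> e0)\<close>, so the excess weight is at most
    \<open>a / 2\<close>.\<close>
  define M where "M = 2 * \<sigma> e0 + 1"
  \<comment> \<open>The inequality \<open>gap\<close> amounts to
    \<open>(3 + 2 * a) * (C * \<delta>) \<le> a * Q / 2\<close>; since \<open>a \<le> 1\<close>, it
    suffices that \<open>C * \<delta> = a * Q / 10\<close>.\<close>
  define \<delta> where "\<delta> = a * Q / (10 * C)"
  have Q: "0 < Q" using e0(2) assms C_pos by (auto simp: Q_def)
  have a: "0 < a" "a \<le> 1" using \<sigma>_nonneg[OF e0(1)] by (auto simp: a_def)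
  have \<delta>: "0 < \<delta>" "C * \<delta> = a * Q / 10" using C_pos a Q by (auto simp: \<delta>_def)
  have gap: "(1 + a / 2) * (Q + 2 * (C * \<delta>)) \<le> (1 + a) * (Q - C * \<delta>)"
  proof -
    have "(1 + a) * (Q - C * \<delta>) - (1 + a / 2) * (Q + 2 * (C * \<delta>)) = a * Q * (2 - 2 * a) / 10"
      unfolding \<delta>(2) by (simp add: field_simps)
    also have "\<dots> \<ge> 0" using a Q by simp
    finally show ?thesis by simp
  qed
  have "p (z + h) \<le> p z + 2 * \<eta>"
    if z: "norm (z - x) < \<delta>" and h: "norm h < \<delta>" and \<eta>: "0 \<le> \<eta>"
      and small: "\<forall>e\<in>E. \<sigma> e \<le> M \<longrightarrow> \<bar>e h\<bar> \<le> \<eta>" for z h \<eta>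
  proof (rule p_least)
    fix e assume e: "e \<in> E"
    have dz: "\<bar>e' (z - x)\<bar> \<le> C * \<delta>" if "e' \<in> E" for e'
      using abs_le[OF that, of "z - x"] z C_pos by (smt (verit) mult_left_mono)
    show "\<phi> e * \<bar>e (z + h)\<bar> \<le> p z + 2 * \<eta>"
    proof (cases "\<sigma> e \<le> M")
      case True
      have "\<bar>e (z + h)\<bar> \<le> \<bar>e z\<bar> + \<bar>e h\<bar>" by (simp add: blinfun.add_right)
      then have "\<phi> e * \<bar>e (z + h)\<bar> \<le> \<phi> e * (\<bar>e z\<bar> + \<bar>e h\<bar>)"
        using \<phi>_bounds[OF e] by (intro mult_left_mono) auto
      also have "\<dots> = \<phi> e * \<bar>e z\<bar> + \<phi> e * \<bar>e h\<bar>" by (simp add: distrib_left)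
      also have "\<phi> e * \<bar>e h\<bar> \<le> 2 * \<eta>"
        using \<phi>_bounds[OF e] small e True by (intro mult_mono) auto
      finally show ?thesis using p_upper[OF e, of z] by linarith
    next
      case False
      have "1 / (1 + \<sigma> e) \<le> 1 / (2 * (1 + \<sigma> e0))"
        using False \<sigma>_nonneg[OF e0(1)] by (intro divide_left_mono) (auto simp: M_def)
      then have \<phi>: "\<phi> e \<le> 1 + a / 2" by (simp add: \<phi>_def a_def algebra_simps)
      have "\<bar>e h\<bar> \<le> C * \<delta>" using abs_le[OF e, of h] h C_pos by (smt (verit) mult_left_mono)
      moreover have "e (z + h) = e x + e (z - x) + e h"
        by (simp add: blinfun.add_right blinfun.diff_right)
      ultimately have "\<bar>e (z + h)\<bar> \<le> Q + 2 * (C * \<delta>)"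
        using dz[OF e] e0(3)[OF e] unfolding Q_def by linarith
      then have "\<phi> e * \<bar>e (z + h)\<bar> \<le> (1 + a / 2) * (Q + 2 * (C * \<delta>))"
        using \<phi> a by (intro mult_mono) auto
      also note gap
      also have "Q - C * \<delta> \<le> \<bar>e0 z\<bar>"
        using dz[OF e0(1)] unfolding Q_def by (simp add: blinfun.diff_right)
      then have "(1 + a) * (Q - C * \<delta>) \<le> \<phi> e0 * \<bar>e0 z\<bar>"
        using a by (auto simp: \<phi>_def a_def intro!: mult_left_mono)
      also have "\<dots> \<le> p z" by (rule p_upper[OF e0(1)])
      finally show ?thesis using \<eta> by simp
    qed
  qed
  then show ?thesis using \<delta>(1) by blast
qed

text \<open>A finite subcover makes the local data uniform: the least radius and the largest level
  serve all of \<open>K\<close>.\<close>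

lemma p_determined_on_compact:
  assumes "compact K" "0 \<notin> K"
  shows "\<exists>\<delta>>0. \<exists>M. \<forall>z\<in>K. \<forall>h \<eta>. norm h < \<delta> \<longrightarrow> 0 \<le> \<eta> \<longrightarrow>
    (\<forall>e\<in>E. \<sigma> e \<le> M \<longrightarrow> \<bar>e h\<bar> \<le> \<eta>) \<longrightarrow> p (z + h) \<le> p z + 2 * \<eta>"
proof -
  have "\<forall>x\<in>K. \<exists>\<delta> M. 0 < \<delta> \<and> (\<forall>z h \<eta>. norm (z - x) < \<delta> \<longrightarrow> norm h < \<delta> \<longrightarrow> 0 \<le> \<eta> \<longrightarrow>
    (\<forall>e\<in>E. \<sigma> e \<le> M \<longrightarrow> \<bar>e h\<bar> \<le> \<eta>) \<longrightarrow> p (z + h) \<le> p z + 2 * \<eta>)"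
  proof
    fix x assume "x \<in> K"
    then have "x \<noteq> 0" using assms(2) by auto
    from p_locally_determined[OF this]
    show "\<exists>\<delta> M. 0 < \<delta> \<and> (\<forall>z h \<eta>. norm (z - x) < \<delta> \<longrightarrow> norm h < \<delta> \<longrightarrow> 0 \<le> \<eta> \<longrightarrow>
      (\<forall>e\<in>E. \<sigma> e \<le> M \<longrightarrow> \<bar>e h\<bar> \<le> \<eta>) \<longrightarrow> p (z + h) \<le> p z + 2 * \<eta>)" by blast
  qed
  then obtain \<delta> M where dM: "\<And>x. x \<in> K \<Longrightarrow> 0 < (\<delta> x :: real)"
    "\<And>x z h \<eta>. x \<in> K \<Longrightarrow> norm (z - x) < \<delta> x \<Longrightarrow> norm h < \<delta> x \<Longrightarrow> 0 \<le> \<eta> \<Longrightarrow>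
      (\<forall>e\<in>E. \<sigma> e \<le> M x \<longrightarrow> \<bar>e h\<bar> \<le> \<eta>) \<Longrightarrow> p (z + h) \<le> p z + 2 * \<eta>"
    by metis
  have "K \<subseteq> (\<Union>x\<in>K. ball x (\<delta> x))" using dM(1) by auto
  then obtain D where D: "D \<subseteq> K" "finite D" "K \<subseteq> (\<Union>x\<in>D. ball x (\<delta> x))"
    using compactE_image[OF assms(1), of K "\<lambda>x. ball x (\<delta> x)"] by auto
  \<comment> \<open>The inserted elements \<open>1\<close> and \<open>0\<close> keep
    \<open>Min\<close> and \<open>Max\<close> meaningful when \<open>D\<close> is empty.\<close>
  define d where "d = Min (insert 1 (\<delta> ` D))"
  define m where "m = Max (insert 0 (M ` D))"
  have "0 < d" using D dM(1) by (auto simp: d_def)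
  moreover have "p (z + h) \<le> p z + 2 * \<eta>"
    if z: "z \<in> K" and h: "norm h < d" "0 \<le> \<eta>" "\<forall>e\<in>E. \<sigma> e \<le> m \<longrightarrow> \<bar>e h\<bar> \<le> \<eta>" for z h \<eta>
  proof -
    obtain x where x: "x \<in> D" "norm (z - x) < \<delta> x"
      using D(3) z by (auto simp: dist_norm norm_minus_commute)
    have "d \<le> \<delta> x" "M x \<le> m" using x D(2) by (auto simp: d_def m_def)
    then show ?thesis using x h D(1) by (intro dM(2)[of x]) auto
  qed
  ultimately show ?thesis by blast
qed

section \<open>Step lengths that hardly increase \<open>p\<close>\<close>

abbreviation Y :: "'a set" where "Y \<equiv> closed_span (range y)"

lemma subspace_Y: "subspace Y"
  unfolding closed_span_def by (intro subspace_closure_normed subspace_span)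

lemma closed_Y: "closed Y"
  unfolding closed_span_def by simp

lemma y_in_Y: "y n \<in> Y"
  unfolding closed_span_def by (intro subsetD[OF closure_subset] span_base) auto

text \<open>The length \<open>t\<close> is fixed before the tolerance \<open>\<eta>\<close>, so
  steps of one length exist for arbitrarily small errors. Smallness of \<open>e\<^sub>0 h\<close>
  will keep signed sums away from \<open>0\<close>, and \<open>t \<le> 1\<close> bounds the set of
  lengths so that its supremum makes sense.\<close>

definition admissible :: "('a \<Rightarrow>\<^sub>L real) \<Rightarrow> 'a set \<Rightarrow> real \<Rightarrow> bool" where
  "admissible e\<^sub>0 K t \<longleftrightarrow> 0 < t \<and> t \<le> 1 \<and> (\<forall>\<eta>>0. \<exists>h\<in>Y. norm h = t \<and> \<bar>e\<^sub>0 h\<bar> \<le> \<eta> \<and>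
     (\<forall>z\<in>K. p (z + h) \<le> p z + \<eta> \<and> p (z - h) \<le> p z + \<eta>))"

lemma admissible_subset: "admissible e\<^sub>0 K t \<Longrightarrow> A \<subseteq> K \<Longrightarrow> admissible e\<^sub>0 A t"
  unfolding admissible_def by (meson subsetD)

end

section \<open>Construction of \<open>c0\<close> when the sums are unbounded\<close>

locale unbounded_boundary = attaining_boundary +
  assumes unbounded: "\<exists>e\<in>E. B < \<sigma> e"
begin

text \<open>If \<open>\<sigma> e\<close> is huge, adding the \<open>y i\<close> with the signs of
  \<open>e (y i)\<close> gives a vector of huge norm, while functionals with
  \<open>\<sigma> f \<le> M\<close> are at most \<open>M\<close> on it. Normalising makes them
  small.\<close>

lemma small_unit_vector:
  assumes "0 < \<eta>"
  shows "\<exists>w\<in>Y. norm w = 1 \<and> (\<forall>e\<in>E. \<sigma> e \<le> M \<longrightarrow> \<bar>e w\<bar> \<le> \<eta>)"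
proof -
  \<comment> \<open>Replacing \<open>M\<close> by a positive number ensures that
    \<open>m / \<eta> < norm s\<close> forces \<open>s\<close> to be nonzero.\<close>
  define m where "m = max M 1"
  obtain e where e: "e \<in> E" "C * (m / \<eta>) < \<sigma> e" using unbounded by blast
  have "\<exists>n. C * (m / \<eta>) < (\<Sum>i<n. \<bar>e (y i)\<bar>)"
  proof (rule ccontr)
    assume "\<not> ?thesis"
    then have "\<sigma> e \<le> C * (m / \<eta>)"
      unfolding \<sigma>_def by (intro suminf_le_const summable_y e) (auto simp: not_less)
    then show False using e by simp
  qed
  then obtain n where n: "C * (m / \<eta>) < (\<Sum>i<n. \<bar>e (y i)\<bar>)" by blast
  define s where "s = (\<Sum>i<n. sgn (e (y i)) *\<^sub>R y i)"
  have "e s = (\<Sum>i<n. \<bar>e (y i)\<bar>)"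
    by (simp add: s_def blinfun.sum_right blinfun.scaleR_right abs_sgn mult.commute)
  then have "C * (m / \<eta>) < C * norm s" using n abs_le[OF e(1), of s] by linarith
  then have ms: "m / \<eta> < norm s" using C_pos by (simp only: mult_less_cancel_left_pos)
  then have s0: "0 < norm s" using assms by (smt (verit) divide_pos_pos m_def)
  have "\<bar>f ((1 / norm s) *\<^sub>R s)\<bar> \<le> \<eta>" if f: "f \<in> E" "\<sigma> f \<le> M" for f
  proof -
    have "\<bar>f s\<bar> \<le> (\<Sum>i<n. \<bar>sgn (e (y i)) * f (y i)\<bar>)"
      unfolding s_def by (simp only: blinfun.sum_right blinfun.scaleR_right real_scaleR_def sum_abs)
    also have "\<dots> \<le> (\<Sum>i<n. \<bar>f (y i)\<bar>)"
      by (intro sum_mono) (auto simp: abs_mult abs_sgn_eq)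
    also have "\<dots> \<le> m" using sum_le_\<sigma>[OF f(1), of "{..<n}"] f(2) by (auto simp: m_def)
    also have "\<dots> \<le> \<eta> * norm s" using ms assms by (simp add: field_simps)
    finally show ?thesis using s0 by (simp add: blinfun.scaleR_right field_simps)
  qed
  moreover have "(1 / norm s) *\<^sub>R s \<in> Y"
    unfolding s_def by (intro subspace_scale subspace_sum subspace_Y y_in_Y)
  moreover have "norm ((1 / norm s) *\<^sub>R s) = 1" using s0 by simp
  ultimately show ?thesis by blast
qed

text \<open>Compactness fixes the length \<open>t < \<delta>\<close> independently of the tolerance;
  a unit vector small at the right level is then scaled by \<open>t\<close>.\<close>

lemma admissible_compact:
  assumes K: "compact K" "0 \<notin> K" and e0: "e\<^sub>0 \<in> E"
  shows "\<exists>t. admissible e\<^sub>0 K t"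
proof -
  obtain \<delta> M where \<delta>: "0 < \<delta>" and M: "\<And>z h \<eta>. z \<in> K \<Longrightarrow> norm h < \<delta> \<Longrightarrow> 0 \<le> \<eta> \<Longrightarrow>
    (\<forall>e\<in>E. \<sigma> e \<le> M \<longrightarrow> \<bar>e h\<bar> \<le> \<eta>) \<Longrightarrow> p (z + h) \<le> p z + 2 * \<eta>"
    using p_determined_on_compact[OF K] by blast
  define t where "t = min 1 (\<delta> / 2)"
  have t: "0 < t" "t \<le> 1" "t < \<delta>" using \<delta> by (auto simp: t_def)
  have "\<exists>h\<in>Y. norm h = t \<and> \<bar>e\<^sub>0 h\<bar> \<le> \<eta> \<and> (\<forall>z\<in>K. p (z + h) \<le> p z + \<eta> \<and> p (z - h) \<le> p z + \<eta>)"
    if \<eta>: "0 < \<eta>" for \<eta>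
  proof -
    have "0 < \<eta> / 2" using \<eta> by simp
    from small_unit_vector[OF this, of "max M (\<sigma> e\<^sub>0)"]
    obtain w where w: "w \<in> Y" "norm w = 1" "\<And>e. e \<in> E \<Longrightarrow> \<sigma> e \<le> max M (\<sigma> e\<^sub>0) \<Longrightarrow> \<bar>e w\<bar> \<le> \<eta> / 2"
      by blast
    have tw: "\<bar>e (t *\<^sub>R w)\<bar> \<le> \<eta> / 2" if "e \<in> E" "\<sigma> e \<le> max M (\<sigma> e\<^sub>0)" for e
      using mult_mono[OF t(2) w(3)[OF that]] t(1) by (simp add: blinfun.scaleR_right abs_mult)
    have "p (z + t *\<^sub>R w) \<le> p z + \<eta>" "p (z - t *\<^sub>R w) \<le> p z + \<eta>" if "z \<in> K" for z
      using M[OF that, of "t *\<^sub>R w" "\<eta> / 2"] M[OF that, of "- (t *\<^sub>R w)" "\<eta> / 2"] t \<eta> tw w(2)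
      by (auto simp: blinfun.minus_right)
    moreover have "\<bar>e\<^sub>0 (t *\<^sub>R w)\<bar> \<le> \<eta>" using tw[OF e0] \<eta> by simp
    moreover have "t *\<^sub>R w \<in> Y" "norm (t *\<^sub>R w) = t"
      using w t by (auto intro: subspace_scale subspace_Y)
    ultimately show ?thesis by blast
  qed
  then show ?thesis unfolding admissible_def using t by blast
qed

text \<open>The supremum of the admissible lengths need not be attained, so a length above half of
  it is taken; hence the factor \<open>2\<close>.\<close>

lemma near_maximal_step:
  assumes A: "finite A" "0 \<notin> A" and e0: "e\<^sub>0 \<in> E" and \<eta>: "0 < \<eta>"
  shows "\<exists>h\<in>Y. \<bar>e\<^sub>0 h\<bar> \<le> \<eta> \<and> (\<forall>z\<in>A. p (z + h) \<le> p z + \<eta> \<and> p (z - h) \<le> p z + \<eta>) \<and>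
    (\<forall>t. admissible e\<^sub>0 A t \<longrightarrow> t \<le> 2 * norm h)"
proof -
  let ?S = "{t. admissible e\<^sub>0 A t}"
  obtain t0 where t0: "admissible e\<^sub>0 A t0"
    using admissible_compact[OF finite_imp_compact[OF A(1)] A(2) e0] by blast
  have bdd: "bdd_above ?S" by (rule bdd_aboveI[of _ 1]) (auto simp: admissible_def)
  have "0 < t0" using t0 by (simp add: admissible_def)
  also have "t0 \<le> Sup ?S" using t0 bdd by (intro cSup_upper) auto
  finally have "Sup ?S / 2 < Sup ?S" by simp
  then obtain t where t: "admissible e\<^sub>0 A t" "Sup ?S / 2 < t"
    using less_cSup_iff[OF _ bdd, of "Sup ?S / 2"] t0 by auto
  then obtain h where h: "h \<in> Y" "norm h = t" "\<bar>e\<^sub>0 h\<bar> \<le> \<eta>"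
    "\<forall>z\<in>A. p (z + h) \<le> p z + \<eta> \<and> p (z - h) \<le> p z + \<eta>"
    using \<eta> unfolding admissible_def by blast
  have "t' \<le> 2 * norm h" if "admissible e\<^sub>0 A t'" for t'
    using cSup_upper[OF _ bdd, of t'] that t(2) h(2) by simp
  then show ?thesis using h by blast
qed

text \<open>If \<open>c0\<close> does not embed, near-maximal steps \<open>u k\<close> keep all
  signed sums bounded in \<open>p\<close>, so their tails are small and the closure \<open>K\<close>
  of the signed sums is compact. One length admissible for \<open>K\<close> bounds every
  \<open>norm (u k)\<close> from below, contradicting the small tails.\<close>

lemma c0_embeds: "c0_embeds_in Y"
proof (rule ccontr)
  assume no_c0: "\<not> c0_embeds_in Y"
  obtain w :: 'a where w: "norm w = 1" using small_unit_vector[OF zero_less_one] by blast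
  obtain e0 where e0: "e0 \<in> E" "norm w \<le> C * \<bar>e0 w\<bar>" using norming by blast
  define Q where "Q = \<bar>e0 w\<bar>"
  have Q: "0 < Q" using e0(2) w by (auto simp: Q_def)
  \<comment> \<open>The tolerances add up to \<open>Q / 2\<close>, and \<open>s k\<close> is the sum
    of the first \<open>k\<close> of them. Thus \<open>e0\<close> keeps absolute value at least
    \<open>Q / 2\<close> on all signed sums.\<close>
  define \<eta> where "\<eta> k = Q / 4 * (1 / 2) ^ k" for k :: nat
  define s where "s k = Q / 2 * (1 - (1 / 2) ^ k)" for k :: nat
  have \<eta>_pos: "0 < \<eta> k" for k using Q by (simp add: \<eta>_def)
  have s_Suc: "s (Suc k) = s k + \<eta> k" for k by (simp add: s_def \<eta>_def algebra_simps)
  have s_le: "s k \<le> Q / 2" for k using Q by (simp add: s_def)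
  have "\<forall>A \<eta>. \<exists>h. finite A \<longrightarrow> 0 \<notin> A \<longrightarrow> 0 < \<eta> \<longrightarrow> h \<in> Y \<and> \<bar>e0 h\<bar> \<le> \<eta> \<and>
      (\<forall>z\<in>A. p (z + h) \<le> p z + \<eta> \<and> p (z - h) \<le> p z + \<eta>) \<and>
      (\<forall>t. admissible e0 A t \<longrightarrow> t \<le> 2 * norm h)"
    using near_maximal_step[OF _ _ e0(1)] by meson
  then obtain H where H: "\<And>A \<eta>. finite A \<Longrightarrow> 0 \<notin> A \<Longrightarrow> 0 < \<eta> \<Longrightarrow> H A \<eta> \<in> Y \<and> \<bar>e0 (H A \<eta>)\<bar> \<le> \<eta> \<and>
      (\<forall>z\<in>A. p (z + H A \<eta>) \<le> p z + \<eta> \<and> p (z - H A \<eta>) \<le> p z + \<eta>) \<and>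
      (\<forall>t. admissible e0 A t \<longrightarrow> t \<le> 2 * norm (H A \<eta>))"
    by metis
  define A where "A = rec_nat {w} (\<lambda>k A. (\<lambda>z. z + H A (\<eta> k)) ` A \<union> (\<lambda>z. z - H A (\<eta> k)) ` A)"
  define u where "u k = H (A k) (\<eta> k)" for k
  have A_0: "A 0 = {w}" by (simp add: A_def)
  have A_Suc: "A (Suc k) = (\<lambda>z. z + u k) ` A k \<union> (\<lambda>z. z - u k) ` A k" for k
    by (simp add: A_def u_def)
  have A_inv: "finite (A k) \<and> (\<forall>z\<in>A k. Q - s k \<le> \<bar>e0 z\<bar> \<and> p z \<le> p w + s k)"
    and A_nz: "0 \<notin> A k" for k
  proof -
    \<comment> \<open>Isolated first because the induction needs \<open>0 \<notin> A k\<close>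
      before it can use the properties of the step \<open>u k\<close>.\<close>
    have nz: "0 \<notin> A k" if "\<forall>z\<in>A k. Q - s k \<le> \<bar>e0 z\<bar>" for k
      using that s_le[of k] Q by force
    show inv: "finite (A k) \<and> (\<forall>z\<in>A k. Q - s k \<le> \<bar>e0 z\<bar> \<and> p z \<le> p w + s k)"
    proof (induction k)
      case 0
      then show ?case by (simp add: A_0 s_def Q_def)
    next
      case (Suc k)
      then have h: "\<bar>e0 (u k)\<bar> \<le> \<eta> k" "\<forall>z\<in>A k. p (z + u k) \<le> p z + \<eta> k \<and> p (z - u k) \<le> p z + \<eta> k"
        using H[of "A k" "\<eta> k"] nz[of k] \<eta>_pos by (auto simp: u_def)
      have "Q - s (Suc k) \<le> \<bar>e0 (z + u k)\<bar> \<and> p (z + u k) \<le> p w + s (Suc k)"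
        "Q - s (Suc k) \<le> \<bar>e0 (z - u k)\<bar> \<and> p (z - u k) \<le> p w + s (Suc k)" if "z \<in> A k" for z
        using Suc that h by (force simp: s_Suc blinfun.add_right blinfun.diff_right)+
      then show ?case using Suc by (auto simp: A_Suc)
    qed
    then show "0 \<notin> A k" using nz by blast
  qed
  have u_Y: "u k \<in> Y" and u_max: "admissible e0 (A k) t \<Longrightarrow> t \<le> 2 * norm (u k)" for k t
    using H[of "A k" "\<eta> k"] A_inv[of k] A_nz[of k] \<eta>_pos by (auto simp: u_def)
  have signed: "w + (\<Sum>i<n. a i *\<^sub>R u i) \<in> A n" if "\<And>i. a i = 1 \<or> a i = -1" for a :: "nat \<Rightarrow> real" and n
  proof (induction n)
    case 0
    then show ?case by (simp add: A_0)
  next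
    case (Suc n)
    then show ?case using that[of n]
      by (auto simp: A_Suc add.assoc[symmetric] image_iff simp del: add_uminus_conv_diff)
  qed
  have uB: "(\<Sum>i\<in>F. \<bar>e (u i)\<bar>) \<le> 2 * p w + Q" if e: "e \<in> E" and F: "finite F" for e F
  proof -
    obtain n where n: "F \<subseteq> {..<n}" using F finite_nat_iff_bounded by blast
    \<comment> \<open>With the signs matched to \<open>e\<close>, the value of \<open>e\<close> at
      the signed sum is \<open>e w\<close> plus all the \<open>\<bar>e (u i)\<bar>\<close>, while
      \<open>p\<close> bounds both \<open>\<bar>e z\<bar>\<close> and
      \<open>\<bar>e w\<bar>\<close>.\<close>
    define a where "a i = (if 0 \<le> e (u i) then 1 else -1 :: real)" for i
    define z where "z = w + (\<Sum>i<n. a i *\<^sub>R u i)"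
    have "z \<in> A n" unfolding z_def by (rule signed) (auto simp: a_def)
    then have "p z \<le> p w + Q" using A_inv[of n] s_le[of n] Q by force
    moreover have "e z = e w + (\<Sum>i<n. \<bar>e (u i)\<bar>)"
      by (auto simp: z_def blinfun.add_right blinfun.sum_right blinfun.scaleR_right a_def intro!: sum.cong)
    moreover have "(\<Sum>i\<in>F. \<bar>e (u i)\<bar>) \<le> (\<Sum>i<n. \<bar>e (u i)\<bar>)" using n by (intro sum_mono2) auto
    ultimately show ?thesis using abs_le_p[OF e, of z] abs_le_p[OF e, of w] by linarith
  qed
  have tails: "\<exists>N. \<forall>F a. finite F \<longrightarrow> F \<subseteq> {N..} \<longrightarrow> (\<forall>i\<in>F. \<bar>a i\<bar> \<le> 1) \<longrightarrow> norm (\<Sum>i\<in>F. a i *\<^sub>R u i) < \<epsilon>"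
    if "0 < \<epsilon>" for \<epsilon>
    by (rule signed_tails_small[OF subspace_Y closed_Y u_Y no_c0 C_pos norm_le norming uB that])
  \<comment> \<open>Later stages differ from stage \<open>n\<close> by a signed tail only, so the
    finitely many points up to a late stage form a net for all of them.\<close>
  have A_near: "\<exists>z'\<in>A n. \<exists>a. (\<forall>i. \<bar>a i\<bar> \<le> (1 :: real)) \<and> z = z' + (\<Sum>i\<in>{n..<m}. a i *\<^sub>R u i)"
    if "n \<le> m" "z \<in> A m" for n m z
    using that
  proof (induction m arbitrary: z rule: dec_induct)
    case base
    then show ?case by (intro bexI[of _ z] exI[of _ "\<lambda>_. 0"]) auto
  next
    case (step m)
    obtain z1 c where z1: "z1 \<in> A m" "\<bar>c\<bar> \<le> (1 :: real)" "z = z1 + c *\<^sub>R u m"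
    proof -
      from step.prems consider z1 where "z1 \<in> A m" "z = z1 + u m" | z1 where "z1 \<in> A m" "z = z1 - u m"
        by (auto simp: A_Suc)
      then show ?thesis
        using that[of _ 1] that[of _ "-1"] by cases auto
    qed
    from step.IH[OF z1(1)] obtain z' a where a: "z' \<in> A n" "\<forall>i. \<bar>a i\<bar> \<le> (1 :: real)"
      "z1 = z' + (\<Sum>i\<in>{n..<m}. a i *\<^sub>R u i)" by blast
    have "(\<Sum>i\<in>{n..<m}. (a(m := c)) i *\<^sub>R u i) = (\<Sum>i\<in>{n..<m}. a i *\<^sub>R u i)"
      by (intro sum.cong) auto
    then have "z = z' + (\<Sum>i\<in>{n..<Suc m}. (a(m := c)) i *\<^sub>R u i)"
      using a(3) z1(3) step.hyps by (simp add: add.assoc)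
    then show ?case using a(1,2) z1(2) by (intro bexI[of _ z'] exI[of _ "a(m := c)"]) auto
  qed
  define K where "K = closure (\<Union>k. A k)"
  have "compact K"
    unfolding compact_eq_totally_bounded
  proof (intro conjI allI impI)
    show "complete K" by (simp add: K_def complete_eq_closed)
    fix \<epsilon> :: real assume "0 < \<epsilon>"
    then have "0 < \<epsilon> / 2" by simp
    from tails[OF this] obtain N where N: "\<And>F a. finite F \<Longrightarrow> F \<subseteq> {N..} \<Longrightarrow> (\<forall>i\<in>F. \<bar>a i\<bar> \<le> 1) \<Longrightarrow>
        norm (\<Sum>i\<in>F. a i *\<^sub>R u i) < \<epsilon> / 2"
      by blast
    have "\<exists>z'\<in>(\<Union>k\<le>N. A k). dist z' x < \<epsilon>" if x: "x \<in> K" for x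
    proof -
      obtain m z where z: "z \<in> A m" "dist z x < \<epsilon> / 2"
        using x half_gt_zero[OF \<open>0 < \<epsilon>\<close>] unfolding K_def closure_approachable by blast
      have "\<exists>z'\<in>(\<Union>k\<le>N. A k). dist z' z < \<epsilon> / 2"
      proof (cases "m \<le> N")
        case True
        then show ?thesis using z(1) \<open>0 < \<epsilon>\<close> by (intro bexI[of _ z]) auto
      next
        case False
        then obtain z' a where a: "z' \<in> A N" "\<forall>i. \<bar>a i\<bar> \<le> 1" "z = z' + (\<Sum>i\<in>{N..<m}. a i *\<^sub>R u i)"
          using A_near[of N m z] z(1) by auto
        have "norm (\<Sum>i\<in>{N..<m}. a i *\<^sub>R u i) < \<epsilon> / 2" using a(2) by (intro N) auto
        then have "dist z' z < \<epsilon> / 2" using a(3) by (simp add: dist_norm)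
        then show ?thesis using a(1) by blast
      qed
      then show ?thesis using z(2) by (metis dist_triangle_half_l dist_commute)
    qed
    then show "\<exists>k. finite k \<and> K \<subseteq> (\<Union>x\<in>k. ball x \<epsilon>)"
      using A_inv by (intro exI[of _ "\<Union>k\<le>N. A k"]) (auto simp: subset_iff)
  qed
  moreover have "K \<subseteq> {z. Q / 2 \<le> \<bar>e0 z\<bar>}"
    unfolding K_def
  proof (rule closure_minimal)
    have "Q / 2 \<le> \<bar>e0 z\<bar>" if "z \<in> A k" for z k
      using A_inv[of k] s_le[of k] that by force
    then show "(\<Union>k. A k) \<subseteq> {z. Q / 2 \<le> \<bar>e0 z\<bar>}" by blast
    show "closed {z. Q / 2 \<le> \<bar>e0 z\<bar>}" by (intro closed_Collect_le continuous_intros)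
  qed
  then have "0 \<notin> K" using Q by auto
  ultimately obtain t where t: "admissible e0 K t" using admissible_compact e0(1) by blast
  have "A k \<subseteq> K" for k unfolding K_def by (rule subset_trans[OF _ closure_subset]) auto
  \<comment> \<open>Admissibility for \<open>K\<close> passes to each \<open>A k\<close>, and
    \<open>u k\<close> was chosen nearly maximal there.\<close>
  then have le: "t \<le> 2 * norm (u k)" for k by (intro u_max admissible_subset[OF t])
  have "0 < t / 2" using t by (simp add: admissible_def)
  from tails[OF this] obtain N where N: "\<And>F a. finite F \<Longrightarrow> F \<subseteq> {N..} \<Longrightarrow> (\<forall>i\<in>F. \<bar>a i\<bar> \<le> 1) \<Longrightarrow>
      norm (\<Sum>i\<in>F. a i *\<^sub>R u i) < t / 2"
    by blast
  have "norm (u N) < t / 2" using N[of "{N}" "\<lambda>_. 1"] by simp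
  then show False using le[of N] by simp
qed

end

section \<open>Bounded and unbounded sums over the norming set\<close>

theorem theorem1p9:
  fixes y :: "nat \<Rightarrow> 'a::banach"
    and E :: "('a \<Rightarrow>\<^sub>L real) set"
  assumes "isomorphically_precisely_norming E"
    and "\<not> c0_embeds_in (closed_span (range y))"
    and "\<forall>x\<in>E. summable (\<lambda>n. \<bar>blinfun_apply x (y n)\<bar>)"
  shows "unconditionally_summable y"
proof -
  obtain C where C: "1 \<le> C" "\<And>e. e \<in> E \<Longrightarrow> norm e \<le> C"
    "\<And>x. (1 / C) * norm x \<le> (SUP e\<in>E. \<bar>blinfun_apply e x\<bar>)"
    "\<And>x. \<exists>e0\<in>E. \<bar>e0 x\<bar> = (SUP e\<in>E. \<bar>blinfun_apply e x\<bar>)"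
    using assms(1) unfolding isomorphically_precisely_norming_def by blast
  interpret attaining_boundary y E C
  proof
    show "0 < C" using C(1) by simp
    show "norm e \<le> C" if "e \<in> E" for e using that by (rule C(2))
    show "summable (\<lambda>n. \<bar>e (y n)\<bar>)" if "e \<in> E" for e using that assms(3) by blast
    fix x
    obtain e0 where e0: "e0 \<in> E" "\<bar>e0 x\<bar> = (SUP e\<in>E. \<bar>blinfun_apply e x\<bar>)" using C(4) by blast
    \<comment> \<open>Boundedness makes the real supremum an upper bound, so the functional
      attaining it is maximal.\<close>
    have "bdd_above ((\<lambda>e. \<bar>blinfun_apply e x\<bar>) ` E)"
    proof (rule bdd_aboveI2)
      fix e assume "e \<in> E"
      then show "\<bar>e x\<bar> \<le> C * norm x"
        using blinfun_abs_le[of e x] C(2) by (meson mult_right_mono norm_ge_zero order_trans)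
    qed
    then have "\<bar>e x\<bar> \<le> \<bar>e0 x\<bar>" if "e \<in> E" for e
      unfolding e0(2) using that by (intro cSUP_upper)
    moreover have "norm x \<le> C * \<bar>e0 x\<bar>"
      using C(3)[of x] C(1) unfolding e0(2) by (simp add: pos_divide_le_eq mult.commute)
    ultimately show "\<exists>e0\<in>E. norm x \<le> C * \<bar>e0 x\<bar> \<and> (\<forall>e\<in>E. \<bar>e x\<bar> \<le> \<bar>e0 x\<bar>)"
      using e0(1) by blast
  qed
  show ?thesis
  proof (cases "\<exists>B. \<forall>e\<in>E. \<sigma> e \<le> B")
    case True
    then obtain B where B: "\<And>e. e \<in> E \<Longrightarrow> \<sigma> e \<le> B" by blast
    have yB: "(\<Sum>i\<in>F. \<bar>e (y i)\<bar>) \<le> B" if "e \<in> E" "finite F" for e F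
      using sum_le_\<sigma>[OF that] B[OF that(1)] by linarith
    show ?thesis
    proof (rule unconditionally_summable_if_tails_small)
      fix \<epsilon> :: real assume "0 < \<epsilon>"
      from signed_tails_small[OF subspace_Y closed_Y y_in_Y assms(2) C_pos norm_le norming yB this]
      obtain N where N: "\<And>F a. finite F \<Longrightarrow> F \<subseteq> {N..} \<Longrightarrow> (\<forall>i\<in>F. \<bar>a i\<bar> \<le> 1) \<Longrightarrow>
          norm (\<Sum>i\<in>F. a i *\<^sub>R y i) < \<epsilon>" by blast
      show "\<exists>N. \<forall>F. finite F \<longrightarrow> F \<subseteq> {N..} \<longrightarrow> norm (\<Sum>i\<in>F. y i) < \<epsilon>"
        using N[of _ "\<lambda>_. 1"] by auto
    qed
  next
    case False
    \<comment> \<open>Here \<open>c0\<close> would embed in the closed span, so this case cannot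
      occur.\<close>
    interpret unbounded_boundary y E C
      by unfold_locales (use False in \<open>simp add: not_le Bex_def Ball_def\<close>)
    show ?thesis using c0_embeds assms(2) by blast
  qed
qed

end
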